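(* For all integers $n\ge k\ge 2$ with $n$ divisible by $k$, there are $n$-vertex $k$-graphs $H_1$ and $H_2$ such that $\mathcal{C}\left(H_1,\left\lfloor\frac{k-1}{k}n\right\rfloor\right)=\mathcal{C}\left(H_2,\left\lfloor\frac{k-1}{k}n\right\rfloor\right)$, but $m_k(H_1,x)\ne m_k(H_2,x)$.
   Context: A $k$-graph is a finite $k$-uniform hypergraph: a finite vertex set together with finitely many (hyper)edges, each incident with exactly $k$ distinct vertices. Multi-edges are allowed, i.e. distinct edges may have the same vertex set. A matching is a set of pairwise vertex-disjoint edges. For an $n$-vertex $k$-graph $H$, the matching polynomial is $$m_k(H,x)=\sum_{i=0}^{\lfloor n/k\rfloor}(-1)^i p(H,i)x^{n-ki},$$ where $p(H,i)$ is the number of distinct matchings of $i$ edges in $H$, and $p(H,0)=1$. For $X\subseteq V(H)$, the induced sub-hypergraph $H[X]$ has vertex set $X$ and all edges of $H$ (with multiplicity) whose vertices all lie in $X$. For an integer $t\ge 0$, $\mathcal{C}(H,t)$ is the multiset of induced $t$-vertex sub-$k$-graphs of $H$, regarded as unlabeled, i.e. the multiset of isomorphism classes of $H[X]$ as $X$ ranges over all $t$-element subsets of $V(H)$. *)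

theory Defs
  imports
    Complex_Main
    "HOL-Library.Multiset"
    "HOL-Library.Disjoint_Sets"
    "HOL-Computational_Algebra.Polynomial"
begin

text \<open>Edges are objects of their own, each incident with a set of vertices, so that distinct
  edges may have the same vertex set. The values of \<open>ends\<close> outside \<open>edges\<close> are irrelevant.\<close>

record ('v, 'e) hypergraph =
  verts :: "'v set"
  edges :: "'e set"
  ends :: "'e \<Rightarrow> 'v set"

definition k_graph :: "nat \<Rightarrow> ('v, 'e) hypergraph \<Rightarrow> bool" where
  "k_graph k H \<longleftrightarrow> finite (verts H) \<and> finite (edges H) \<and>
     (\<forall>e \<in> edges H. ends H e \<subseteq> verts H \<and> card (ends H e) = k)"

text \<open>A matching is a set of edges, so parallel edges give rise to different matchings.\<close>

definition matching :: "('v, 'e) hypergraph \<Rightarrow> 'e set \<Rightarrow> bool" where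
  "matching H M \<longleftrightarrow> M \<subseteq> edges H \<and> disjoint_family_on (ends H) M"

definition num_matchings :: "('v, 'e) hypergraph \<Rightarrow> nat \<Rightarrow> nat" where
  "num_matchings H i = card {M. matching H M \<and> card M = i}"

definition matching_poly :: "nat \<Rightarrow> ('v, 'e) hypergraph \<Rightarrow> int poly" where
  "matching_poly k H = (let n = card (verts H) in
     \<Sum>i = 0..n div k. monom ((-1) ^ i * int (num_matchings H i)) (n - k * i))"

definition induced_sub :: "('v, 'e) hypergraph \<Rightarrow> 'v set \<Rightarrow> ('v, 'e) hypergraph" where
  "induced_sub H X = \<lparr>verts = X, edges = {e \<in> edges H. ends H e \<subseteq> X}, ends = ends H\<rparr>"

definition hypergraph_iso :: "('v, 'e) hypergraph \<Rightarrow> ('w, 'f) hypergraph \<Rightarrow> bool" where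
  "hypergraph_iso G H \<longleftrightarrow> (\<exists>f g. bij_betw f (verts G) (verts H) \<and> bij_betw g (edges G) (edges H) \<and>
     (\<forall>e \<in> edges G. ends H (g e) = f ` ends G e))"

definition iso_class :: "('v, 'e) hypergraph \<Rightarrow> ('v, 'e) hypergraph set" where
  "iso_class G = {G'. hypergraph_iso G G'}"

text \<open>The multiset of unlabeled induced subhypergraphs on \<open>t\<close> vertices.\<close>

definition deck :: "('v, 'e) hypergraph \<Rightarrow> nat \<Rightarrow> ('v, 'e) hypergraph set multiset" where
  "deck H t = image_mset (\<lambda>X. iso_class (induced_sub H X)) (mset_set {X. X \<subseteq> verts H \<and> card X = t})"

end

theory Submission
  imports Defs
begin

text \<open>
  Put \<open>n = k m\<close> and \<open>d = k - 2\<close>. The two hypergraphs are ladders whose rungs are missing: two tracks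
  \<open>0\<close> and \<open>1\<close> of vertices arranged by levels \<open>0, \<dots>, m\<close>, where levels \<open>1, \<dots>, m - 1\<close> carry a vertex on
  both tracks, level \<open>0\<close> carries a vertex on track \<open>0\<close> only, and level \<open>m\<close> carries a single vertex,
  on track \<open>0\<close> or on track \<open>1\<close>; this last choice is the only difference between the hypergraphs. There
  are further \<open>m\<close> pairwise disjoint hubs \<open>Z\<^sub>0, \<dots>, Z\<^sub>m\<^sub>-\<^sub>1\<close> of \<open>d\<close> vertices each, and the edges are
  the sets consisting of two consecutive vertices of a track, at levels \<open>p\<close> and \<open>p + 1\<close>, together with
  the hub \<open>Z\<^sub>p\<close>. For \<open>k = 2\<close> this is the graph pair \<open>P\<^sub>m \<union> P\<^sub>m\<close> and \<open>P\<^sub>m\<^sub>+\<^sub>1 \<union> P\<^sub>m\<^sub>-\<^sub>1\<close>.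

  Equality of decks: cards arise by deleting \<open>m\<close> vertices. Either a vertex of some hub \<open>Z\<^sub>p\<close> is
  deleted, or only \<open>m\<close> track vertices survive, so that one of the \<open>m + 1\<close> levels is empty. In both cases
  there is a \<open>p\<close> such that no edge between levels \<open>p\<close> and \<open>p + 1\<close> survives, and none would even if the
  surviving vertices were moved to other tracks (\<open>ex_severed\<close>). Exchanging the two tracks above level \<open>p\<close> therefore
  turns the card into an isomorphic card of the other hypergraph (\<open>iso_crossover\<close>). Whether \<open>p\<close> has
  this property depends only on the surviving hub vertices and on the levels of the surviving track
  vertices, and neither changes under the exchange; hence, when the least such \<open>p\<close> is always used, the correspondence of cards is bijective.

  Inequality of matching polynomials: the constant coefficient is, up to sign, the number of perfect
  matchings. Starting from the bottom of the two tracks, the edges of a perfect matching are forced: there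
  is one at each level \<open>p\<close>, on the track given by the parity of \<open>p\<close> (\<open>zigzag_forced\<close>). These edges are
  indeed pairwise disjoint, and the last one exists only in the hypergraph whose top vertex lies on the
  track given by the parity of \<open>m - 1\<close>. Thus exactly one of the two has a perfect matching.
\<close>

section \<open>Isomorphism, decks and perfect matchings\<close>

lemma hypergraph_iso_sym:
  assumes "hypergraph_iso G H" and "\<forall>e \<in> edges G. ends G e \<subseteq> verts G"
  shows "hypergraph_iso H G"
proof -
  obtain f g where f: "bij_betw f (verts G) (verts H)" and g: "bij_betw g (edges G) (edges H)"
    and fg: "\<forall>e \<in> edges G. ends H (g e) = f ` ends G e"
    using assms(1) unfolding hypergraph_iso_def by blast
  let ?f = "inv_into (verts G) f" and ?g = "inv_into (edges G) g"
  have "ends G (?g e) = ?f ` ends H e" if "e \<in> edges H" for e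
  proof -
    have e: "?g e \<in> edges G" "g (?g e) = e"
      using that g by (auto simp: bij_betw_def intro: inv_into_into f_inv_into_f)
    then have "ends H e = f ` ends G (?g e)" using fg by metis
    moreover have "ends G (?g e) \<subseteq> verts G" using e assms(2) by blast
    ultimately show ?thesis
      using f by (simp add: bij_betw_def inv_into_image_cancel)
  qed
  then show ?thesis
    unfolding hypergraph_iso_def using bij_betw_inv_into[OF f] bij_betw_inv_into[OF g] by blast
qed

lemma hypergraph_iso_trans:
  assumes "hypergraph_iso G H" and "hypergraph_iso H K"
  shows "hypergraph_iso G K"
proof -
  obtain f g where f: "bij_betw f (verts G) (verts H)" and g: "bij_betw g (edges G) (edges H)"
    and fg: "\<forall>e \<in> edges G. ends H (g e) = f ` ends G e"
    using assms(1) unfolding hypergraph_iso_def by blast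
  obtain f' g' where f': "bij_betw f' (verts H) (verts K)" and g': "bij_betw g' (edges H) (edges K)"
    and fg': "\<forall>e \<in> edges H. ends K (g' e) = f' ` ends H e"
    using assms(2) unfolding hypergraph_iso_def by blast
  have "\<forall>e \<in> edges G. ends K ((g' \<circ> g) e) = (f' \<circ> f) ` ends G e"
    using fg fg' bij_betwE[OF g] by (simp add: image_comp)
  then show ?thesis
    unfolding hypergraph_iso_def using bij_betw_trans[OF f f'] bij_betw_trans[OF g g'] by blast
qed

lemma iso_class_eq:
  assumes "hypergraph_iso G H" and "\<forall>e \<in> edges G. ends G e \<subseteq> verts G"
  shows "iso_class G = iso_class H"
  unfolding iso_class_def
  using hypergraph_iso_trans[OF assms(1)] hypergraph_iso_trans[OF hypergraph_iso_sym[OF assms]]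
  by blast

lemma deck_eqI:
  assumes "bij_betw \<Phi> {X. X \<subseteq> verts G \<and> card X = t} {X. X \<subseteq> verts H \<and> card X = t}"
    and "\<And>X. X \<subseteq> verts G \<Longrightarrow> card X = t \<Longrightarrow>
      hypergraph_iso (induced_sub G X) (induced_sub H (\<Phi> X))"
  shows "deck G t = deck H t"
proof -
  let ?A = "{X. X \<subseteq> verts G \<and> card X = t}" and ?B = "{X. X \<subseteq> verts H \<and> card X = t}"
  have "mset_set ?B = mset_set (\<Phi> ` ?A)"
    using bij_betw_imp_surj_on[OF assms(1)] by simp
  also have "\<dots> = image_mset \<Phi> (mset_set ?A)"
    by (rule image_mset_mset_set[OF bij_betw_imp_inj_on[OF assms(1)], symmetric])
  finally have B: "mset_set ?B = image_mset \<Phi> (mset_set ?A)" .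
  have "iso_class (induced_sub G X) = iso_class (induced_sub H (\<Phi> X))"
    if "X \<in># mset_set ?A" for X
  proof (rule iso_class_eq)
    have "X \<in> ?A"
      using that by (metis elem_mset_set empty_iff mset_set.infinite set_mset_empty)
    then show "hypergraph_iso (induced_sub G X) (induced_sub H (\<Phi> X))"
      using assms(2) by simp
  qed (simp add: induced_sub_def)
  then show ?thesis
    unfolding deck_def B multiset.map_comp comp_def by (intro image_mset_cong)
qed

text \<open>The smaller matchings contribute positive powers of the variable only.\<close>

lemma coeff_0_matching_poly:
  assumes "card (verts H) = k * m" and "0 < k"
  shows "coeff (matching_poly k H) 0 = (-1) ^ m * int (num_matchings H m)"
proof -
  have "coeff (matching_poly k H) 0 =
      (\<Sum>i = 0..m. if i = m then (-1) ^ i * int (num_matchings H i) else 0)"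
    using assms unfolding matching_poly_def Let_def coeff_sum by (intro sum.cong) auto
  then show ?thesis by simp
qed

lemma perfect_matching_covers:
  assumes "k_graph k H" and "card (verts H) = k * m" and "matching H M" and "card M = m"
  shows "(\<Union>e \<in> M. ends H e) = verts H"
proof (rule card_subset_eq)
  have M: "M \<subseteq> edges H" and fin: "finite (verts H)" "finite (edges H)"
    and E: "\<forall>e \<in> edges H. ends H e \<subseteq> verts H \<and> card (ends H e) = k"
    using assms unfolding k_graph_def matching_def by auto
  show "finite (verts H)" by (fact fin)
  show "(\<Union>e \<in> M. ends H e) \<subseteq> verts H" using M E by blast
  have "card (\<Union>e \<in> M. ends H e) = (\<Sum>e \<in> M. card (ends H e))"
  proof (rule card_UN_disjoint')
    show "disjoint_family_on (ends H) M" using assms(3) by (simp add: matching_def)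
    show "finite M" using M fin(2) by (rule finite_subset)
    show "finite (ends H e)" if "e \<in> M" for e using that M E fin(1) by (meson finite_subset subsetD)
  qed
  also have "\<dots> = (\<Sum>e \<in> M. k)" using M E by (intro sum.cong) auto
  finally show "card (\<Union>e \<in> M. ends H e) = card (verts H)"
    using assms(2,4) by (simp add: mult.commute)
qed

section \<open>The two ladders\<close>

context
  fixes m d :: nat
begin

text \<open>The vertex at level \<open>l\<close> of track \<open>s\<close> is the number \<open>2 l + s\<close>, so that levels are obtained by
  \<open>_ div 2\<close> and \<open>v + 2\<close> is the successor of \<open>v\<close> on its track. The parameter \<open>\<tau>\<close> is the track of the top
  vertex.\<close>

definition track_verts :: "nat \<Rightarrow> nat set" where
  "track_verts \<tau> = {0} \<union> {2..<2 * m} \<union> {2 * m + \<tau>}"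

definition hub :: "nat \<Rightarrow> nat set" where
  "hub p = {2 * m + 2 + p * d..<2 * m + 2 + (p + 1) * d}"

text \<open>An edge is named by the lower one of its two track vertices.\<close>

definition ladder :: "nat \<Rightarrow> (nat, nat) hypergraph" where
  "ladder \<tau> = \<lparr>verts = track_verts \<tau> \<union> {2 * m + 2..<2 * m + 2 + m * d},
     edges = {e. e \<in> track_verts \<tau> \<and> e + 2 \<in> track_verts \<tau>},
     ends = (\<lambda>e. {e, e + 2} \<union> hub (e div 2))\<rparr>"

lemma hub_subset: "p < m \<Longrightarrow> hub p \<subseteq> {2 * m + 2..<2 * m + 2 + m * d}"
proof -
  assume "p < m"
  then have "(p + 1) * d \<le> m * d" by (intro mult_right_mono) auto
  then show ?thesis unfolding hub_def by auto
qed

lemma hub_cover: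
  assumes "v \<in> {2 * m + 2..<2 * m + 2 + m * d}"
  shows "\<exists>p<m. v \<in> hub p"
proof -
  define u where "u = v - (2 * m + 2)"
  have u: "v = 2 * m + 2 + u" "u < m * d" using assms unfolding u_def by auto
  then have "0 < d" by (cases d) auto
  have "u div d < m" using u(2) by (simp add: less_mult_imp_div_less)
  moreover have "u div d * d \<le> u" "u < (u div d + 1) * d"
    using \<open>0 < d\<close> by (simp, metis Suc_eq_plus1 dividend_less_div_times mult_Suc)
  ultimately show ?thesis using u(1) unfolding hub_def by auto
qed

lemma hub_disjoint:
  assumes "p \<noteq> q"
  shows "hub p \<inter> hub q = {}"
proof -
  have *: "hub p \<inter> hub q = {}" if "p < q" for p q
  proof -
    have "(p + 1) * d \<le> q * d" using that by (intro mult_right_mono) auto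
    then show ?thesis unfolding hub_def by auto
  qed
  show ?thesis using *[of p q] *[of q p] assms by (cases p q rule: linorder_cases) auto
qed

lemma edge_level:
  assumes "e \<in> edges (ladder \<tau>)" and "\<tau> < 2"
  shows "e div 2 < m"
  using assms unfolding ladder_def track_verts_def by auto

lemma k_graph_ladder:
  assumes "\<tau> < 2"
  shows "k_graph (d + 2) (ladder \<tau>)"
proof -
  have "ends (ladder \<tau>) e \<subseteq> verts (ladder \<tau>) \<and> card (ends (ladder \<tau>) e) = d + 2"
    if e: "e \<in> edges (ladder \<tau>)" for e
  proof -
    have p: "e div 2 < m" by (rule edge_level[OF e assms])
    then have "e < 2 * m" by auto
    then have "{e, e + 2} \<inter> hub (e div 2) = {}" using hub_subset[OF p] by force
    then have "card ({e, e + 2} \<union> hub (e div 2)) = d + 2"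
      by (subst card_Un_disjoint) (auto simp: hub_def)
    then show ?thesis using e hub_subset[OF p] unfolding ladder_def by auto
  qed
  then show ?thesis unfolding k_graph_def by (auto simp: ladder_def track_verts_def)
qed

lemma card_verts_ladder:
  assumes "0 < m" and "\<tau> < 2"
  shows "card (verts (ladder \<tau>)) = (d + 2) * m"
proof -
  have "card (track_verts \<tau>) = 2 * m" using assms unfolding track_verts_def
    by (subst card_Un_disjoint) auto
  then show ?thesis using assms unfolding ladder_def
    by (subst hypergraph.simps, subst card_Un_disjoint) (auto simp: track_verts_def algebra_simps)
qed

section \<open>Exchanging the tracks above a severed level\<close>

definition crossover :: "nat \<Rightarrow> nat \<Rightarrow> nat" where
  "crossover p v =
     (if p < v div 2 \<and> v div 2 \<le> m then (if even v then v + 1 else v - 1) else v)"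

lemma crossover_level [simp]: "crossover p v div 2 = v div 2"
  unfolding crossover_def by (auto elim!: oddE evenE)

lemma crossover_crossover [simp]: "crossover p (crossover p v) = v"
proof -
  have "crossover p v = (if p < crossover p v div 2 \<and> crossover p v div 2 \<le> m
      then (if even v then v + 1 else v - 1) else v)"
    unfolding crossover_level by (simp add: crossover_def)
  then show ?thesis
    unfolding crossover_def[of p "crossover p v"] crossover_level by (auto simp: crossover_def)
qed

lemma crossover_image_image [simp]: "crossover p ` crossover p ` X = X"
  by (simp add: image_image)

lemma inj_crossover: "inj (crossover p)"
  by (metis crossover_crossover injI)

lemma crossover_hub_vertex: "2 * m + 2 \<le> v \<Longrightarrow> crossover p v = v"
  unfolding crossover_def by auto

lemma crossover_image_hub:
  assumes "q < m"
  shows "crossover p ` hub q = hub q"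
proof -
  have "\<forall>v \<in> hub q. crossover p v = v"
    using hub_subset[OF assms] crossover_hub_vertex by auto
  then show ?thesis by force
qed

lemma crossover_in_track_verts:
  assumes "p < m" and "\<tau> < 2" and "v \<in> track_verts \<tau>"
  shows "crossover p v \<in> track_verts (1 - \<tau>)"
proof -
  consider "v = 0" | "2 \<le> v" "v < 2 * m" | "v = 2 * m + \<tau>"
    using assms(3) unfolding track_verts_def by auto
  then show ?thesis
  proof cases
    case 1
    then show ?thesis by (simp add: crossover_def track_verts_def)
  next
    case 2
    have "0 < v div 2" "v div 2 < m" using 2 by auto
    then have "0 < crossover p v div 2" "crossover p v div 2 < m" by simp_all
    then have "2 \<le> crossover p v" "crossover p v < 2 * m" by linarith+
    then show ?thesis by (simp add: track_verts_def)
  next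
    case 3
    then show ?thesis using assms(1,2) by (cases "\<tau> = 0") (auto simp: crossover_def track_verts_def)
  qed
qed

lemma crossover_in_verts:
  assumes "p < m" and "\<tau> < 2" and "v \<in> verts (ladder \<tau>)"
  shows "crossover p v \<in> verts (ladder (1 - \<tau>))"
  using assms crossover_in_track_verts[OF assms(1,2)] crossover_hub_vertex
  by (auto simp: ladder_def)

lemma crossover_add_2:
  assumes "v div 2 \<noteq> p" and "v div 2 < m"
  shows "crossover p (v + 2) = crossover p v + 2"
  using assms unfolding crossover_def by (auto elim: oddE)

text \<open>Severed means that no edge between levels \<open>p\<close> and \<open>p + 1\<close> survives in \<open>X\<close>, and that none can
  appear when the vertices of \<open>X\<close> change tracks. That \<open>X\<close> contains no edge at level \<open>p\<close> would not be
  enough: with \<open>X\<close> containing vertices at levels \<open>p\<close> and \<open>p + 1\<close> on different tracks, the exchange could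
  create one.\<close>

definition severed :: "nat set \<Rightarrow> nat \<Rightarrow> bool" where
  "severed X p \<longleftrightarrow> p < m \<and>
     (\<not> hub p \<subseteq> X \<or> (\<forall>v \<in> X. v div 2 \<noteq> p) \<or> (\<forall>v \<in> X. v div 2 \<noteq> p + 1))"

lemma severed_crossover [simp]: "severed (crossover p ` X) q = severed X q"
proof -
  have "hub q \<subseteq> crossover p ` X \<longleftrightarrow> hub q \<subseteq> X" if "q < m"
    by (metis crossover_image_hub[OF that] crossover_image_image image_mono)
  then show ?thesis unfolding severed_def by auto
qed

text \<open>If all hubs survived, together with a vertex at each of the \<open>m + 1\<close> levels, then \<open>X\<close> would have
  more than \<open>d m + m\<close> elements.\<close>

lemma ex_severed:
  assumes "0 < m" and "finite X" and "card X = (d + 1) * m"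
  shows "\<exists>p. severed X p"
proof (rule ccontr)
  assume none: "\<nexists>p. severed X p"
  let ?Z = "{2 * m + 2..<2 * m + 2 + m * d}" and ?L = "{v \<in> X. v div 2 \<le> m}"
  have hubs: "hub p \<subseteq> X" and lower: "\<exists>v \<in> X. v div 2 = p"
    and upper: "\<exists>v \<in> X. v div 2 = p + 1" if "p < m" for p
    using none that by (auto simp: severed_def)
  have "?Z \<subseteq> X" using hub_cover hubs by blast
  have "{0..m} \<subseteq> (\<lambda>v. v div 2) ` ?L"
  proof
    fix l assume l: "l \<in> {0..m}"
    have "\<exists>v \<in> X. v div 2 = l"
    proof (cases "l < m")
      case True
      then show ?thesis by (rule lower)
    next
      case False
      then have "l = (m - 1) + 1" "m - 1 < m" using l assms(1) by auto
      then show ?thesis using upper by metis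
    qed
    then show "l \<in> (\<lambda>v. v div 2) ` ?L" using l by auto
  qed
  then have "card {0..m} \<le> card ?L"
    using assms(2) by (intro surj_card_le) auto
  moreover have "card (?L \<union> ?Z) \<le> card X"
    using \<open>?Z \<subseteq> X\<close> assms(2) by (intro card_mono) auto
  moreover have "card (?L \<union> ?Z) = card ?L + card ?Z"
    using assms(2) by (intro card_Un_disjoint) auto
  ultimately show False using assms(3) by (simp add: algebra_simps)
qed

text \<open>An edge of the card lies entirely below or entirely above the severed level: below, it is fixed;
  above, it moves to the other track as a whole. The hubs do not move, so the image is again an edge.\<close>

lemma crossover_induced_edge:
  assumes "severed X p" and "\<tau> < 2" and "e \<in> edges (induced_sub (ladder \<tau>) X)"
  shows "crossover p e \<in> edges (induced_sub (ladder (1 - \<tau>)) (crossover p ` X))"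
    and "ends (ladder (1 - \<tau>)) (crossover p e) = crossover p ` ends (ladder \<tau>) e"
proof -
  have e: "e \<in> edges (ladder \<tau>)" "ends (ladder \<tau>) e \<subseteq> X"
    using assms(3) by (auto simp: induced_sub_def)
  then have ends: "e \<in> X" "e + 2 \<in> X" "hub (e div 2) \<subseteq> X"
    by (auto simp: ladder_def)
  have p: "p < m" using assms(1) by (simp add: severed_def)
  have l: "e div 2 < m" using edge_level e(1) assms(2) by blast
  have "e div 2 \<noteq> p"
  proof
    assume "e div 2 = p"
    moreover from this have "(e + 2) div 2 = p + 1" by simp
    ultimately show False using assms(1) ends unfolding severed_def by blast
  qed
  note step = crossover_add_2[OF this l]
  show *: "ends (ladder (1 - \<tau>)) (crossover p e) = crossover p ` ends (ladder \<tau>) e"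
    using step crossover_image_hub[OF l] by (simp add: ladder_def image_Un)
  have "crossover p e \<in> edges (ladder (1 - \<tau>))"
    using e(1) crossover_in_track_verts[OF p assms(2)] step by (force simp: ladder_def)
  moreover have "ends (ladder (1 - \<tau>)) (crossover p e) \<subseteq> crossover p ` X"
    using * e(2) by auto
  ultimately show "crossover p e \<in> edges (induced_sub (ladder (1 - \<tau>)) (crossover p ` X))"
    by (simp add: induced_sub_def)
qed

lemma iso_crossover:
  assumes "severed X p" and "\<tau> < 2"
  shows "hypergraph_iso (induced_sub (ladder \<tau>) X) (induced_sub (ladder (1 - \<tau>)) (crossover p ` X))"
    (is "hypergraph_iso ?G ?H")
  unfolding hypergraph_iso_def
proof (intro exI conjI ballI)
  show "bij_betw (crossover p) (verts ?G) (verts ?H)"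
    using inj_crossover by (auto simp: bij_betw_def induced_sub_def intro: inj_on_subset)
  have "1 - (1 - \<tau>) = \<tau>" using assms(2) by simp
  then have "crossover p e \<in> edges ?G" if "e \<in> edges ?H" for e
    using crossover_induced_edge(1)[of "crossover p ` X" p "1 - \<tau>" e] assms that by simp
  then show "bij_betw (crossover p) (edges ?G) (edges ?H)"
    using crossover_induced_edge(1)[OF assms]
    by (intro bij_betw_byWitness[where f' = "crossover p"]) auto
  show "ends ?H (crossover p e) = crossover p ` ends ?G e" if "e \<in> edges ?G" for e
    using crossover_induced_edge(2)[OF assms that] by (simp add: induced_sub_def)
qed

lemma deck_ladder:
  assumes "0 < m"
  shows "deck (ladder 0) ((d + 1) * m) = deck (ladder 1) ((d + 1) * m)"
proof -
  let ?C = "\<lambda>\<tau>. {X. X \<subseteq> verts (ladder \<tau>) \<and> card X = (d + 1) * m}"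
  define \<Phi> where "\<Phi> X = crossover (LEAST p. severed X p) ` X" for X
  have severed: "severed X (LEAST p. severed X p)" if "X \<in> ?C \<tau>" for X \<tau>
  proof -
    have "finite (verts (ladder \<tau>))" by (simp add: ladder_def track_verts_def)
    then have "finite X" using that finite_subset by auto
    then show ?thesis using ex_severed[OF assms] that by (auto intro: LeastI_ex)
  qed
  have maps: "\<Phi> X \<in> ?C (1 - \<tau>)" if "\<tau> < 2" "X \<in> ?C \<tau>" for X \<tau>
  proof -
    have "(LEAST p. severed X p) < m" using severed[OF that(2)] by (simp add: severed_def)
    then have "\<Phi> X \<subseteq> verts (ladder (1 - \<tau>))"
      using that crossover_in_verts unfolding \<Phi>_def by blast
    moreover have "card (\<Phi> X) = card X"
      unfolding \<Phi>_def by (intro card_image inj_on_subset[OF inj_crossover]) auto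
    ultimately show ?thesis using that(2) by auto
  qed
  \<comment> \<open>The exchange preserves the set of severed levels, hence the least of them.\<close>
  have "\<Phi> (\<Phi> X) = X" for X by (simp add: \<Phi>_def)
  then have "bij_betw \<Phi> (?C 0) (?C 1)"
    using maps[of 0] maps[of 1] by (intro bij_betw_byWitness[where f' = \<Phi>]) (simp_all add: image_subset_iff)
  moreover have "hypergraph_iso (induced_sub (ladder 0) X) (induced_sub (ladder 1) (\<Phi> X))"
    if "X \<in> ?C 0" for X
    using iso_crossover[OF severed[OF that], of 0] by (simp add: \<Phi>_def)
  ultimately show ?thesis by (intro deck_eqI[of \<Phi>]) auto
qed

section \<open>Perfect matchings of the ladders\<close>

text \<open>The edge at level \<open>p\<close> on the track given by the parity of \<open>p\<close>.\<close>

definition zigzag :: "nat \<Rightarrow> nat" where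
  "zigzag p = 2 * p + p mod 2"

lemma zigzag_level [simp]: "zigzag p div 2 = p"
  unfolding zigzag_def by auto

lemma zigzag_in_track_verts: "p < m \<Longrightarrow> zigzag p \<in> track_verts \<tau>"
  unfolding zigzag_def track_verts_def by (cases "p = 0") auto

lemma zigzag_matching:
  assumes "\<tau> = (m + 1) mod 2"
  shows "matching (ladder \<tau>) (zigzag ` {..<m})"
  unfolding matching_def disjoint_family_on_def
proof (intro conjI ballI impI)
  have "zigzag p \<in> edges (ladder \<tau>)" if "p < m" for p
  proof -
    have "zigzag p + 2 \<in> track_verts \<tau>"
    proof (cases "p + 1 = m")
      case True
      then show ?thesis unfolding zigzag_def track_verts_def assms by auto
    next
      case False
      then show ?thesis using that unfolding zigzag_def track_verts_def by auto
    qed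
    then show ?thesis using zigzag_in_track_verts[OF that] by (simp add: ladder_def)
  qed
  then show "zigzag ` {..<m} \<subseteq> edges (ladder \<tau>)" by auto
  fix e f assume "e \<in> zigzag ` {..<m}" "f \<in> zigzag ` {..<m}" "e \<noteq> f"
  then obtain p q where pq: "e = zigzag p" "f = zigzag q" "p < m" "q < m" "p \<noteq> q" by auto
  have small: "zigzag p + 2 < 2 * m + 2" if "p < m" for p
    using that unfolding zigzag_def by linarith
  \<comment> \<open>Consecutive levels use different tracks.\<close>
  have "zigzag p + 2 \<noteq> zigzag q" for p q
  proof
    assume *: "zigzag p + 2 = zigzag q"
    then have "(zigzag p + 2) div 2 = q" by simp
    then have "q = p + 1" by simp
    then show False using * unfolding zigzag_def by presburger
  qed
  moreover have "zigzag p \<noteq> zigzag q" using pq(1,2) \<open>e \<noteq> f\<close> by simp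
  ultimately have "{e, e + 2} \<inter> {f, f + 2} = {}" using pq by (auto dest: sym)
  moreover have "{e, e + 2} \<inter> hub q = {}" "{f, f + 2} \<inter> hub p = {}"
    using hub_subset pq small[of p] small[of q] by fastforce+
  ultimately show "ends (ladder \<tau>) e \<inter> ends (ladder \<tau>) f = {}"
    using hub_disjoint[OF pq(5)] pq by (auto simp: ladder_def)
qed

text \<open>The vertex \<open>zigzag p\<close> can be covered by the edge above it, which is \<open>zigzag p\<close>, or by the one below
  it. For \<open>p \<le> 1\<close> the latter does not exist, as these vertices are the lowest ones of the two tracks;
  for \<open>p \<ge> 2\<close> it meets the edge \<open>zigzag (p - 2)\<close>, which is already in the matching.\<close>

lemma zigzag_forced:
  assumes "0 < m" and "\<tau> < 2" and M: "matching (ladder \<tau>) M" "card M = m" and "p < m"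
  shows "zigzag p \<in> M"
  using \<open>p < m\<close>
proof (induction p rule: less_induct)
  case (less p)
  have ME: "M \<subseteq> edges (ladder \<tau>)" using M by (simp add: matching_def)
  have "(\<Union>e \<in> M. ends (ladder \<tau>) e) = verts (ladder \<tau>)"
    by (rule perfect_matching_covers[OF k_graph_ladder[OF assms(2)] card_verts_ladder[OF assms(1,2)] M])
  moreover have "zigzag p \<in> verts (ladder \<tau>)"
    using zigzag_in_track_verts[OF less.prems] by (simp add: ladder_def)
  ultimately have "zigzag p \<in> (\<Union>e \<in> M. ends (ladder \<tau>) e)" by (simp only:)
  then obtain e where e: "e \<in> M" "zigzag p \<in> ends (ladder \<tau>) e" by blast
  have "e div 2 < m" using ME e(1) by (intro edge_level[OF _ assms(2)]) auto
  then have "hub (e div 2) \<subseteq> {2 * m + 2..<2 * m + 2 + m * d}" by (rule hub_subset)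
  moreover have "zigzag p < 2 * m + 2" using less.prems unfolding zigzag_def by linarith
  ultimately have "zigzag p \<notin> hub (e div 2)" by auto
  then consider "e = zigzag p" | "e + 2 = zigzag p" using e(2) by (auto simp: ladder_def)
  then show ?case
  proof cases
    case 1
    then show ?thesis using e by simp
  next
    case 2
    show ?thesis
    proof (cases "p < 2")
      case True
      then have "p = 0 \<or> p = 1" by auto
      then have "e = 1" using 2 by (auto simp: zigzag_def)
      moreover have "1 \<notin> track_verts \<tau>" using assms(1) by (auto simp: track_verts_def)
      moreover have "e \<in> track_verts \<tau>" using e(1) ME by (auto simp: ladder_def)
      ultimately show ?thesis by simp
    next
      case False
      define q where "q = p - 2"
      have q: "p = q + 2" using False by (simp add: q_def)
      have eq: "e = zigzag q + 2" using 2 unfolding zigzag_def q by simp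
      have "zigzag q \<in> M" using less.IH[of q] less.prems unfolding q by simp
      moreover have "e \<noteq> zigzag q" using eq by simp
      ultimately have "ends (ladder \<tau>) e \<inter> ends (ladder \<tau>) (zigzag q) = {}"
        using M(1) e(1) by (meson disjoint_family_onD matching_def)
      moreover have "e \<in> ends (ladder \<tau>) e" "e \<in> ends (ladder \<tau>) (zigzag q)"
        using eq by (simp_all add: ladder_def)
      ultimately show ?thesis by blast
    qed
  qed
qed

lemma num_perfect_matchings_ladder:
  assumes "0 < m" and "\<tau> < 2"
  shows "0 < num_matchings (ladder \<tau>) m \<longleftrightarrow> \<tau> = (m + 1) mod 2"
proof
  assume "0 < num_matchings (ladder \<tau>) m"
  then obtain M where "matching (ladder \<tau>) M" "card M = m"
    unfolding num_matchings_def by (metis (mono_tags, lifting) card_gt_0_iff empty_Collect_eq)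
  then have "zigzag (m - 1) \<in> edges (ladder \<tau>)"
    using zigzag_forced[OF assms, of M "m - 1"] assms(1) by (auto simp: matching_def)
  then have "zigzag (m - 1) + 2 \<in> track_verts \<tau>" by (simp add: ladder_def)
  moreover have "zigzag (m - 1) + 2 = 2 * m + (m + 1) mod 2"
    using assms(1) unfolding zigzag_def by (cases m) auto
  ultimately show "\<tau> = (m + 1) mod 2" using assms(1) by (auto simp: track_verts_def)
next
  assume "\<tau> = (m + 1) mod 2"
  then have "matching (ladder \<tau>) (zigzag ` {..<m})" by (rule zigzag_matching)
  moreover have "card (zigzag ` {..<m}) = m"
    by (subst card_image) (auto intro: inj_on_inverseI[of _ "\<lambda>v. v div 2"])
  moreover have "finite {M. matching (ladder \<tau>) M \<and> card M = m}"
    by (rule finite_subset[of _ "Pow (edges (ladder \<tau>))"])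
      (auto simp: matching_def ladder_def track_verts_def)
  ultimately show "0 < num_matchings (ladder \<tau>) m"
    unfolding num_matchings_def card_gt_0_iff by blast
qed

lemma matching_poly_ladder:
  assumes "0 < m"
  shows "matching_poly (d + 2) (ladder 0) \<noteq> matching_poly (d + 2) (ladder 1)"
proof
  assume "matching_poly (d + 2) (ladder 0) = matching_poly (d + 2) (ladder 1)"
  then have "num_matchings (ladder 0) m = num_matchings (ladder 1) m"
    using coeff_0_matching_poly[OF card_verts_ladder[OF assms, of 0]]
      coeff_0_matching_poly[OF card_verts_ladder[OF assms, of 1]] by simp
  then have "(0 = (m + 1) mod 2) = (1 = (m + 1) mod 2)"
    using num_perfect_matchings_ladder[OF assms, of 0] num_perfect_matchings_ladder[OF assms, of 1]
    by simp
  then show False by (cases "even m") auto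
qed

end

section \<open>Non-reconstructibility of the matching polynomial\<close>

theorem theorem5p1:
  fixes n k :: nat
  assumes "2 \<le> k" and "k \<le> n" and "k dvd n"
  shows "\<exists>H\<^sub>1 H\<^sub>2 :: (nat, nat) hypergraph.
    k_graph k H\<^sub>1 \<and> card (verts H\<^sub>1) = n \<and>
    k_graph k H\<^sub>2 \<and> card (verts H\<^sub>2) = n \<and>
    deck H\<^sub>1 (nat \<lfloor>(real k - 1) / real k * real n\<rfloor>) = deck H\<^sub>2 (nat \<lfloor>(real k - 1) / real k * real n\<rfloor>) \<and>
    matching_poly k H\<^sub>1 \<noteq> matching_poly k H\<^sub>2"
proof -
  obtain m where n: "n = k * m" using assms(3) by (rule dvdE)
  define d where "d = k - 2"
  have k: "k = d + 2" using assms(1) by (simp add: d_def)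
  have m: "0 < m" using assms(1,2) n by (cases m) auto
  have "(real k - 1) / real k * real n = real ((d + 1) * m)"
    using assms(1) by (simp add: n k field_simps)
  then have t: "nat \<lfloor>(real k - 1) / real k * real n\<rfloor> = (d + 1) * m"
    by (simp only: floor_of_nat nat_int)
  show ?thesis
    unfolding t
  proof (intro exI conjI)
    show "k_graph k (ladder m d 0)" "k_graph k (ladder m d 1)"
      unfolding k by (rule k_graph_ladder; simp)+
    show "card (verts (ladder m d 0)) = n" "card (verts (ladder m d 1)) = n"
      unfolding n k by (rule card_verts_ladder[OF m]; simp)+
    show "deck (ladder m d 0) ((d + 1) * m) = deck (ladder m d 1) ((d + 1) * m)"
      by (rule deck_ladder[OF m])
    show "matching_poly k (ladder m d 0) \<noteq> matching_poly k (ladder m d 1)"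
      unfolding k by (rule matching_poly_ladder[OF m])
  qed
qed

end
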